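(* Let $\alpha\in(0,1)$, $r>0$, and let $X\subset\mathbb{R}^d$ be a set of $n$ points contained in the Euclidean ball $B(0,r)$ with $0\in X$. Then there exists a mapping $f:\mathbb{R}^d\to\mathbb{R}^m$ with $m=O(\alpha^{-2}\log n)$ such that for every $p\in X$ and every $q\in\mathbb{R}^d$, $\left|\,\|p-q\|_2-\|f(p)-f(q)\|_2\,\right|\leq \alpha\cdot r$.
   Context: Such a mapping is called an $\alpha$-additive terminal embedding of $X$. *)

theory Defs
  imports "HOL-Analysis.Analysis"
begin

text \<open>
  A point of \<open>\<real>\<^sup>d\<close> is a sequence vanishing from index \<open>d\<close> on, i.e. an element of
  \<^term>\<open>topspace (Euclidean_space d)\<close>. The dimension is thus a natural number that can be
  quantified in a formula; with type-indexed dimensions the implied constant of a bound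
  \<open>m = O(\<dots>)\<close> could depend on \<open>d\<close>.
\<close>

definition Rn :: "nat \<Rightarrow> (nat \<Rightarrow> real) set"
  where "Rn d = topspace (Euclidean_space d)"

definition norm2 :: "nat \<Rightarrow> (nat \<Rightarrow> real) \<Rightarrow> real"
  where "norm2 d x = L2_set x {..<d}"

definition dist2 :: "nat \<Rightarrow> (nat \<Rightarrow> real) \<Rightarrow> (nat \<Rightarrow> real) \<Rightarrow> real"
  where "dist2 d x y = norm2 d (\<lambda>i. x i - y i)"

end

theory Submission
  imports Defs "HOL-Probability.Probability"
begin

text \<open>
  Let \<open>T\<close> be the set of normalised differences of points of \<open>X\<close> and let \<open>P\<close> be a scaled Gaussian
  matrix with \<open>m = O(\<epsilon>\<^sup>-\<^sup>2 log n)\<close> rows. With positive probability \<open>P\<close> preserves, for every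
  \<open>k \<le> \<epsilon>\<^sup>-\<^sup>2\<close>, the squared norm of all sums of \<open>k\<close> elements of \<open>T\<close> up to a factor \<open>1 \<plusminus> \<epsilon> \<surd>k\<close>:
  there are at most \<open>n\<^sup>2\<^sup>k\<close> such sums and each one fails with probability \<open>2 exp (- c m \<epsilon>\<^sup>2 k)\<close>. Applying
  Maurey's empirical method to \<open>w \<in> conv T\<close> with about \<open>1 / |w|\<^sup>2\<close> samples turns this into
  \<open>|P w| \<ge> |w| - O(\<epsilon>)\<close> on all of \<open>conv T\<close>, with no loss in \<open>\<epsilon>\<close>.

  By convex duality every \<open>v\<close> then has a \<open>u\<close> with \<open>|u| \<le> |v|\<close> and
  \<open>\<langle>u, P t\<rangle> = \<langle>v, t\<rangle> \<plusminus> O(\<epsilon>) |v|\<close> for all \<open>t \<in> T\<close>. A point \<open>q\<close> with nearest point \<open>p\<^sub>0 \<in> X\<close> is mapped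
  to \<open>P p\<^sub>0 + u + sqrt (|v|\<^sup>2 - |u|\<^sup>2) e\<close> where \<open>v = q - p\<^sub>0\<close> and \<open>e\<close> is a unit vector orthogonal to the
  range of \<open>P\<close>. For \<open>p \<in> X\<close> at distance \<open>a\<close> from \<open>q\<close> the squared distance changes by
  \<open>O(\<epsilon>) |p - p\<^sub>0| (|p - p\<^sub>0| + |v|)\<close>, which is \<open>O(\<epsilon> r a)\<close> since \<open>|v| \<le> a\<close>, so the distance changes by
  \<open>O(\<epsilon> r)\<close>.
\<close>

section \<open>Finitely supported sequences as an inner product space\<close>

lemma mem_Rn_iff: "x \<in> Rn d \<longleftrightarrow> (\<forall>i\<ge>d. x i = 0)"
  by (simp add: Rn_def topspace_Euclidean_space)

lemma Rn_mono: "d \<le> e \<Longrightarrow> Rn d \<subseteq> Rn e"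
  by (auto simp: mem_Rn_iff)

text \<open>
  A single type containing every \<open>\<real>\<^sup>d\<close>, so that the theory of the class \<^class>\<open>real_inner\<close> applies
  although both dimensions of the theorem are quantified.
\<close>

typedef fin_seq = "\<Union>d. Rn d" morphisms coord of_coords
  by (auto simp: mem_Rn_iff)

lemma coord_of_coords: "x \<in> Rn d \<Longrightarrow> coord (of_coords x) = x"
  by (blast intro: of_coords_inverse)

lemma fin_seq_eqI: "(\<And>i. coord x i = coord y i) \<Longrightarrow> x = y"
  by (simp add: coord_inject[symmetric] ext)

lemma common_dim:
  obtains d where "coord x \<in> Rn d" "coord y \<in> Rn d"
proof -
  obtain a b where "coord x \<in> Rn a" "coord y \<in> Rn b"
    using coord[of x] coord[of y] by blast
  then show thesis
    using that[of "max a b"] Rn_mono[of a "max a b"] Rn_mono[of b "max a b"] by auto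
qed

lemma coord_of_coords_map2:
  assumes "f 0 0 = 0"
  shows "coord (of_coords (\<lambda>i. f (coord x i) (coord y i))) = (\<lambda>i. f (coord x i) (coord y i))"
proof -
  obtain d where "coord x \<in> Rn d" "coord y \<in> Rn d" by (rule common_dim)
  then have "(\<lambda>i. f (coord x i) (coord y i)) \<in> Rn d" using assms by (simp add: mem_Rn_iff)
  then show ?thesis by (rule coord_of_coords)
qed

instantiation fin_seq :: real_vector
begin

definition "0 = of_coords (\<lambda>_. 0)"

definition "x + y = of_coords (\<lambda>i. coord x i + coord y i)"

definition "x - y = of_coords (\<lambda>i. coord x i - coord y i)"

definition "- x = of_coords (\<lambda>i. - coord x i)"

definition "c *\<^sub>R x = of_coords (\<lambda>i. c * coord x i)"

lemma coord_zero [simp]: "coord 0 i = 0"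
  by (simp add: zero_fin_seq_def coord_of_coords[of _ 0] mem_Rn_iff)

lemma coord_add [simp]: "coord (x + y) i = coord x i + coord y i"
  unfolding plus_fin_seq_def by (simp add: coord_of_coords_map2[where f="(+)"])

lemma coord_diff [simp]: "coord (x - y) i = coord x i - coord y i"
  unfolding minus_fin_seq_def by (simp add: coord_of_coords_map2[where f="(-)"])

lemma coord_uminus [simp]: "coord (- x) i = - coord x i"
  unfolding uminus_fin_seq_def by (simp add: coord_of_coords_map2[where f="\<lambda>a _. - a"])

lemma coord_scaleR [simp]: "coord (c *\<^sub>R x) i = c * coord x i"
  unfolding scaleR_fin_seq_def by (simp add: coord_of_coords_map2[where f="\<lambda>a _. c * a"])

instance
proof
  fix x y z :: fin_seq and a b :: real
  show "x + y + z = x + (y + z)" "x + y = y + x" "0 + x = x" "- x + x = 0" "x - y = x + - y"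
    "a *\<^sub>R (x + y) = a *\<^sub>R x + a *\<^sub>R y" "(a + b) *\<^sub>R x = a *\<^sub>R x + b *\<^sub>R x"
    "a *\<^sub>R b *\<^sub>R x = (a * b) *\<^sub>R x" "1 *\<^sub>R x = x"
    by (auto intro!: fin_seq_eqI simp: algebra_simps)
qed

end

instantiation fin_seq :: real_inner
begin

definition inner_fin_seq :: "fin_seq \<Rightarrow> fin_seq \<Rightarrow> real"
  where "inner_fin_seq x y = (\<Sum>i | coord x i \<noteq> 0. coord x i * coord y i)"

definition norm_fin_seq :: "fin_seq \<Rightarrow> real"
  where "norm_fin_seq x = sqrt (inner x x)"

definition dist_fin_seq :: "fin_seq \<Rightarrow> fin_seq \<Rightarrow> real"
  where "dist_fin_seq x y = norm (x - y)"

definition sgn_fin_seq :: "fin_seq \<Rightarrow> fin_seq"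
  where "sgn_fin_seq x = x /\<^sub>R norm x"

definition uniformity_fin_seq :: "(fin_seq \<times> fin_seq) filter"
  where "uniformity_fin_seq = (INF e\<in>{0<..}. principal {(x, y). dist x y < e})"

definition open_fin_seq :: "fin_seq set \<Rightarrow> bool"
  where "open_fin_seq U \<longleftrightarrow> (\<forall>x\<in>U. \<forall>\<^sub>F (x', y) in uniformity. x' = x \<longrightarrow> y \<in> U)"

lemma inner_fin_seq_eq_sum:
  assumes "coord x \<in> Rn d"
  shows "inner x y = (\<Sum>i<d. coord x i * coord y i)"
  unfolding inner_fin_seq_def using assms
  by (intro sum.mono_neutral_left) (auto simp: mem_Rn_iff not_less[symmetric])

instance
proof
  fix x y z :: fin_seq and a :: real
  obtain d where d: "coord x \<in> Rn d" "coord y \<in> Rn d" by (rule common_dim)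
  then have add: "coord (x + y) \<in> Rn d" and scale: "coord (a *\<^sub>R x) \<in> Rn d"
    by (auto simp: mem_Rn_iff)
  show "inner x y = inner y x"
    using d by (simp add: inner_fin_seq_eq_sum mult.commute)
  show "inner (x + y) z = inner x z + inner y z"
    using d
    by (simp add: inner_fin_seq_eq_sum[OF add] inner_fin_seq_eq_sum sum.distrib distrib_right)
  show "inner (a *\<^sub>R x) y = a * inner x y"
    using d
    by (simp add: inner_fin_seq_eq_sum[OF scale] inner_fin_seq_eq_sum sum_distrib_left mult.assoc)
  show "0 \<le> inner x x"
    by (simp add: inner_fin_seq_def sum_nonneg)
  show "inner x x = 0 \<longleftrightarrow> x = 0"
  proof
    assume "inner x x = 0"
    then have "\<forall>i<d. coord x i = 0"
      using d by (simp add: inner_fin_seq_eq_sum sum_nonneg_eq_0_iff)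
    then show "x = 0"
      using d by (intro fin_seq_eqI) (metis coord_zero mem_Rn_iff not_less)
  qed (simp add: inner_fin_seq_def)
qed (fact norm_fin_seq_def dist_fin_seq_def sgn_fin_seq_def uniformity_fin_seq_def
  open_fin_seq_def)+

end

lemma norm_sq_fin_seq:
  assumes "coord x \<in> Rn d"
  shows "(norm x)\<^sup>2 = (\<Sum>i<d. (coord x i)\<^sup>2)"
  unfolding power2_norm_eq_inner inner_fin_seq_eq_sum[OF assms] by (simp add: power2_eq_square)

lemma norm_fin_seq_eq_norm2:
  assumes "coord x \<in> Rn d"
  shows "norm x = norm2 d (coord x)"
  by (simp add: norm2_def L2_set_def norm_sq_fin_seq[OF assms, symmetric])

lemma dist_fin_seq_eq_dist2:
  assumes "coord x \<in> Rn d" "coord y \<in> Rn d"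
  shows "dist x y = dist2 d (coord x) (coord y)"
proof -
  have "coord (x - y) = (\<lambda>i. coord x i - coord y i)" by (simp add: fun_eq_iff)
  moreover from this have "coord (x - y) \<in> Rn d" using assms by (simp add: mem_Rn_iff)
  ultimately show ?thesis by (simp add: dist_norm dist2_def norm_fin_seq_eq_norm2)
qed

definition fin_seq_unit :: "nat \<Rightarrow> fin_seq"
  where "fin_seq_unit m = of_coords (\<lambda>i. of_bool (i = m))"

lemma coord_fin_seq_unit: "coord (fin_seq_unit m) = (\<lambda>i. of_bool (i = m))"
  unfolding fin_seq_unit_def by (rule coord_of_coords[of _ "Suc m"]) (simp add: mem_Rn_iff)

lemma fin_seq_unit_in_Rn: "coord (fin_seq_unit m) \<in> Rn (Suc m)"
  by (simp add: coord_fin_seq_unit mem_Rn_iff)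

lemma inner_fin_seq_unit: "inner (fin_seq_unit m) x = coord x m"
  by (simp add: inner_fin_seq_eq_sum[OF fin_seq_unit_in_Rn] coord_fin_seq_unit)

lemma norm_fin_seq_unit: "norm (fin_seq_unit m) = 1"
  by (simp add: norm_fin_seq_def inner_fin_seq_unit coord_fin_seq_unit)

lemma subspace_coord_in_Rn: "subspace {x. coord x \<in> Rn d}"
  by (simp add: subspace_def mem_Rn_iff)

section \<open>Norms on convex hulls\<close>

lemma exists_le_convex_combination:
  fixes \<phi> \<mu> :: "'a \<Rightarrow> real"
  assumes "finite T" "\<And>t. t \<in> T \<Longrightarrow> 0 \<le> \<mu> t" "sum \<mu> T = 1"
  shows "\<exists>t\<in>T. \<phi> t \<le> (\<Sum>t\<in>T. \<mu> t * \<phi> t)"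
proof -
  have "T \<noteq> {}" using assms(3) by auto
  define t where "t = arg_min_on \<phi> T"
  have t: "t \<in> T" "\<And>s. s \<in> T \<Longrightarrow> \<phi> t \<le> \<phi> s"
    unfolding t_def using \<open>T \<noteq> {}\<close> assms(1) by (auto intro: arg_min_if_finite arg_min_least)
  have "\<phi> t = (\<Sum>s\<in>T. \<mu> s * \<phi> t)" using assms(3) by (simp flip: sum_distrib_right)
  also have "\<dots> \<le> (\<Sum>s\<in>T. \<mu> s * \<phi> s)" using t(2) assms(2) by (intro sum_mono mult_left_mono)
  finally show ?thesis using t(1) by blast
qed

text \<open>
  The right-hand side is the expectation of the left-hand side for independent samples \<open>ts\<close> with
  distribution \<open>\<mu>\<close>; the samples are chosen one by one so that the conditional expectation never
  increases.
\<close>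

lemma maurey_selection_from:
  fixes B :: "'a::real_vector \<Rightarrow> 'a \<Rightarrow> real"
  assumes B: "bilinear B" "\<And>x y. B x y = B y x"
    and \<mu>: "finite T" "\<And>t. t \<in> T \<Longrightarrow> 0 \<le> \<mu> t" "sum \<mu> T = 1"
    and w: "w = (\<Sum>t\<in>T. \<mu> t *\<^sub>R t)"
  shows "\<exists>ts. set ts \<subseteq> T \<and> length ts = k \<and> B (a + sum_list ts) (a + sum_list ts)
    \<le> B a a + 2 * real k * B a w + real k * (\<Sum>t\<in>T. \<mu> t * B t t) + real k * (real k - 1) * B w w"
proof (induction k arbitrary: a)
  case 0
  show ?case by simp
next
  case (Suc k)
  let ?M = "\<Sum>t\<in>T. \<mu> t * B t t"
  define \<phi> where
    "\<phi> b k = B b b + 2 * real k * B b w + real k * ?M + real k * (real k - 1) * B w w" for b k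
  have B_w: "B y w = (\<Sum>t\<in>T. \<mu> t * B y t)" for y
  proof -
    have "linear (B y)" using B(1) by (simp add: bilinear_def)
    then show ?thesis by (simp add: w linear_sum linear_scale)
  qed
  have "\<phi> (a + t) k = \<phi> a k + 2 * B a t + B t t + 2 * real k * B w t" for t
    by (simp add: \<phi>_def bilinear_ladd[OF B(1)] bilinear_radd[OF B(1)] B(2)[of t a] B(2)[of t w]
        algebra_simps)
  then have "(\<Sum>t\<in>T. \<mu> t * \<phi> (a + t) k)
      = (\<Sum>t\<in>T. \<mu> t * \<phi> a k + 2 * (\<mu> t * B a t) + \<mu> t * B t t + 2 * real k * (\<mu> t * B w t))"
    by (simp add: algebra_simps)
  also have "\<dots> = \<phi> a k + 2 * B a w + ?M + 2 * real k * B w w"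
    using \<mu>(3) by (simp add: sum.distrib B_w flip: sum_distrib_left sum_distrib_right)
  also have "\<dots> = \<phi> a (Suc k)" by (simp add: \<phi>_def algebra_simps)
  finally obtain t where t: "t \<in> T" "\<phi> (a + t) k \<le> \<phi> a (Suc k)"
    using exists_le_convex_combination[OF \<mu>, of "\<lambda>t. \<phi> (a + t) k"] by auto
  obtain ts where "set ts \<subseteq> T" "length ts = k"
    "B ((a + t) + sum_list ts) ((a + t) + sum_list ts) \<le> \<phi> (a + t) k"
    using Suc.IH[of "a + t"] by (auto simp: \<phi>_def)
  then show ?case
    using t by (intro exI[of _ "t # ts"]) (auto simp: \<phi>_def add.assoc)
qed

lemma maurey_selection:
  fixes B :: "'a::real_vector \<Rightarrow> 'a \<Rightarrow> real"
  assumes B: "bilinear B" "\<And>x y. B x y = B y x"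
    and T: "finite T" "w \<in> convex hull T" "\<And>t. t \<in> T \<Longrightarrow> B t t \<le> M"
  obtains ts where "set ts \<subseteq> T" "length ts = k"
    "B (sum_list ts) (sum_list ts) \<le> real k * (M + (real k - 1) * B w w)"
proof -
  obtain \<mu> where \<mu>: "\<And>t. t \<in> T \<Longrightarrow> 0 \<le> \<mu> t" "sum \<mu> T = 1" "(\<Sum>t\<in>T. \<mu> t *\<^sub>R t) = w"
    using T(1,2) by (auto simp: convex_hull_finite)
  obtain ts where ts: "set ts \<subseteq> T" "length ts = k"
    "B (sum_list ts) (sum_list ts)
      \<le> real k * (\<Sum>t\<in>T. \<mu> t * B t t) + real k * (real k - 1) * B w w"
    using maurey_selection_from[OF B T(1) \<mu>(1,2) \<mu>(3)[symmetric], of k 0]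
    by (auto simp: bilinear_lzero[OF B(1)])
  have "(\<Sum>t\<in>T. \<mu> t * B t t) \<le> (\<Sum>t\<in>T. \<mu> t * M)"
    using \<mu>(1) T(3) by (intro sum_mono mult_left_mono)
  also have "\<dots> = M" using \<mu>(2) by (simp flip: sum_distrib_right)
  finally have "real k * (\<Sum>t\<in>T. \<mu> t * B t t) \<le> real k * M" by (simp add: mult_left_mono)
  then show thesis using ts by (intro that) (auto simp: algebra_simps)
qed

definition preserves_norm_sq ::
    "real \<Rightarrow> ('a::real_normed_vector \<Rightarrow> 'b::real_normed_vector) \<Rightarrow> 'a \<Rightarrow> bool"
  where "preserves_norm_sq \<epsilon> P x \<longleftrightarrow> \<bar>(norm (P x))\<^sup>2 - (norm x)\<^sup>2\<bar> \<le> \<epsilon> * (norm x)\<^sup>2"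

lemma preserves_norm_sq_scaleR:
  assumes "linear P" "preserves_norm_sq \<epsilon> P x"
  shows "preserves_norm_sq \<epsilon> P (c *\<^sub>R x)"
proof -
  have "\<bar>(norm (P (c *\<^sub>R x)))\<^sup>2 - (norm (c *\<^sub>R x))\<^sup>2\<bar> = c\<^sup>2 * \<bar>(norm (P x))\<^sup>2 - (norm x)\<^sup>2\<bar>"
    by (simp add: linear_scale[OF assms(1)] power_mult_distrib abs_mult flip: right_diff_distrib)
  also have "\<dots> \<le> c\<^sup>2 * (\<epsilon> * (norm x)\<^sup>2)"
    using assms(2) unfolding preserves_norm_sq_def by (intro mult_left_mono) auto
  finally show ?thesis by (simp add: preserves_norm_sq_def power_mult_distrib mult_ac)
qed

definition preserves_sums ::
    "real \<Rightarrow> 'a::real_normed_vector set \<Rightarrow> ('a \<Rightarrow> 'b::real_normed_vector) \<Rightarrow> bool"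
  where "preserves_sums \<epsilon> T P \<longleftrightarrow>
    (\<forall>ts. set ts \<subseteq> T \<and> \<epsilon> * sqrt (length ts) \<le> 1 \<longrightarrow>
      preserves_norm_sq (\<epsilon> * sqrt (length ts)) P (sum_list ts))"

lemma preserves_sumsD:
  "preserves_sums \<epsilon> T P \<Longrightarrow> set ts \<subseteq> T \<Longrightarrow> \<epsilon> * sqrt (length ts) \<le> 1 \<Longrightarrow>
    preserves_norm_sq (\<epsilon> * sqrt (length ts)) P (sum_list ts)"
  by (simp add: preserves_sums_def)

lemma preserves_sums_singleD:
  "preserves_sums \<epsilon> T P \<Longrightarrow> t \<in> T \<Longrightarrow> \<epsilon> \<le> 1 \<Longrightarrow> preserves_norm_sq \<epsilon> P t"
  using preserves_sumsD[of \<epsilon> T P "[t]"] by simp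

lemma norm_sq_image_ge_on_convex_hull:
  fixes P :: "'a::real_inner \<Rightarrow> 'b::real_inner"
  assumes P: "linear P" "preserves_sums \<epsilon> T P"
    and \<epsilon>: "0 \<le> \<epsilon>" "\<epsilon> \<le> 1" "\<epsilon> * sqrt k \<le> 1" and k: "0 < k"
    and T: "finite T" "T \<subseteq> cball 0 1" "w \<in> convex hull T"
  shows "(real k - 1) * ((1 - \<epsilon> * sqrt k) * (norm w)\<^sup>2 - (norm (P w))\<^sup>2) \<le> \<epsilon> * (1 + sqrt k)"
proof -
  define B where "B x y = inner (P x) (P y) - (1 - \<epsilon> * sqrt k) * inner x y" for x y
  have B_self: "B x x = (norm (P x))\<^sup>2 - (1 - \<epsilon> * sqrt k) * (norm x)\<^sup>2" for x
    by (simp add: B_def power2_norm_eq_inner)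
  have bilinear: "bilinear B"
    unfolding bilinear_def B_def
    by (intro allI conjI linearI)
      (simp_all add: linear_add[OF P(1)] linear_scale[OF P(1)] inner_add algebra_simps)
  have sym: "B x y = B y x" for x y by (simp add: B_def inner_commute)
  have "B t t \<le> \<epsilon> * (1 + sqrt k)" if "t \<in> T" for t
  proof -
    have "B t t \<le> \<epsilon> * (1 + sqrt k) * (norm t)\<^sup>2"
      using preserves_sums_singleD[OF P(2) that \<epsilon>(2)]
      by (simp add: preserves_norm_sq_def B_self algebra_simps)
    also have "\<dots> \<le> \<epsilon> * (1 + sqrt k) * 1"
      using \<epsilon> T(2) that by (intro mult_left_mono) (auto simp: power_le_one)
    finally show ?thesis by simp
  qed
  then obtain ts where ts: "set ts \<subseteq> T" "length ts = k"
    "B (sum_list ts) (sum_list ts) \<le> real k * (\<epsilon> * (1 + sqrt k) + (real k - 1) * B w w)"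
    using maurey_selection[OF bilinear sym T(1,3)] by blast
  have "0 \<le> B (sum_list ts) (sum_list ts)"
    using preserves_sumsD[OF P(2) ts(1)] ts(2) \<epsilon>(3)
    by (simp add: preserves_norm_sq_def B_self algebra_simps)
  also note ts(3)
  finally have "0 \<le> \<epsilon> * (1 + sqrt k) + (real k - 1) * B w w"
    using k by (simp add: zero_le_mult_iff)
  then show ?thesis by (simp add: B_self algebra_simps)
qed

text \<open>
  With about \<open>1 / \<rho>\<^sup>2\<close> samples of a convex combination of norm \<open>\<rho>\<close>, the sampling error \<open>1 / k\<close> of the
  squared norm has the order of \<open>\<rho>\<^sup>2\<close>, and the relative error \<open>\<epsilon> \<surd>k\<close> is \<open>O(\<epsilon> / \<rho>)\<close>.
\<close>

lemma exists_sample_size: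
  fixes \<rho> :: real
  assumes "0 < \<rho>" "\<rho> \<le> 1"
  obtains k :: nat where "0 < k" "1 / \<rho>\<^sup>2 \<le> real k - 1" "sqrt k * \<rho> \<le> 2"
proof
  define k where "k = nat \<lceil>1 / \<rho>\<^sup>2\<rceil> + 1"
  show "0 < k" by (simp add: k_def)
  show "1 / \<rho>\<^sup>2 \<le> real k - 1" by (simp add: k_def real_nat_ceiling_ge)
  have "real k \<le> 1 / \<rho>\<^sup>2 + 2" unfolding k_def using assms(1) by simp linarith
  then have "real k * \<rho>\<^sup>2 \<le> (1 / \<rho>\<^sup>2 + 2) * \<rho>\<^sup>2" by (intro mult_right_mono) auto
  also have "\<dots> = 1 + 2 * \<rho>\<^sup>2" using assms(1) by (simp add: field_simps)
  also have "\<dots> \<le> 2\<^sup>2" using assms power_le_one[of \<rho> 2] by simp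
  finally show "sqrt k * \<rho> \<le> 2"
    by (intro power2_le_imp_le[of "sqrt k * \<rho>" 2]) (simp_all add: power_mult_distrib)
qed

lemma norm_image_ge_on_convex_hull:
  fixes P :: "'a::real_inner \<Rightarrow> 'b::real_inner"
  assumes P: "linear P" "preserves_sums \<epsilon> T P"
    and \<epsilon>: "0 < \<epsilon>" "\<epsilon> \<le> 1"
    and T: "finite T" "T \<subseteq> cball 0 1" "w \<in> convex hull T"
  shows "norm w - 5 * \<epsilon> \<le> norm (P w)"
proof (cases "norm w \<le> 5 * \<epsilon>")
  case True
  then have "norm w - 5 * \<epsilon> \<le> 0" by simp
  also have "0 \<le> norm (P w)" by (rule norm_ge_zero)
  finally show ?thesis .
next
  case False
  let ?\<rho> = "norm w"
  have \<rho>: "0 < ?\<rho>" "5 * \<epsilon> < ?\<rho>" using False \<epsilon> by linarith+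
  have "convex hull T \<subseteq> cball 0 1" using T(2) by (simp add: subset_hull convex_cball)
  then have \<rho>_le_1: "?\<rho> \<le> 1" using T(3) by auto
  obtain k where k: "0 < k" "1 / ?\<rho>\<^sup>2 \<le> real k - 1" "sqrt k * ?\<rho> \<le> 2"
    using exists_sample_size[OF \<rho>(1) \<rho>_le_1] .
  define s where "s = sqrt k"
  have "\<epsilon> * s * ?\<rho> \<le> \<epsilon> * 2" using k(3) \<epsilon> by (simp add: s_def)
  also have "\<dots> \<le> ?\<rho>" using \<rho> \<epsilon> by linarith
  finally have "\<epsilon> * s \<le> 1" using \<rho> by simp
  then have sampled: "(real k - 1) * ((1 - \<epsilon> * s) * ?\<rho>\<^sup>2 - (norm (P w))\<^sup>2) \<le> \<epsilon> * (1 + s)"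
    unfolding s_def using \<epsilon> k(1) by (intro norm_sq_image_ge_on_convex_hull[OF P _ _ _ _ T]) auto
  have "(1 - \<epsilon> * s) * ?\<rho>\<^sup>2 - (norm (P w))\<^sup>2 \<le> \<epsilon> * (1 + s) * ?\<rho>\<^sup>2" (is "?gap \<le> _")
  proof (cases "?gap \<le> 0")
    case True
    also have "0 \<le> \<epsilon> * (1 + s) * ?\<rho>\<^sup>2" using \<epsilon> by (simp add: s_def)
    finally show ?thesis .
  next
    case False
    then have "1 / ?\<rho>\<^sup>2 * ?gap \<le> (real k - 1) * ?gap" using k(2) by (intro mult_right_mono) auto
    also note sampled
    finally show ?thesis using \<rho> by (simp add: pos_divide_le_eq)
  qed
  then have "?\<rho>\<^sup>2 - \<epsilon> * (2 * (s * ?\<rho>) * ?\<rho> + ?\<rho> * ?\<rho>) \<le> (norm (P w))\<^sup>2"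
    by (simp add: algebra_simps power2_eq_square)
  moreover have "\<epsilon> * (2 * (s * ?\<rho>) * ?\<rho> + ?\<rho> * ?\<rho>) \<le> \<epsilon> * (2 * 2 * ?\<rho> + 1 * ?\<rho>)"
    unfolding s_def using k(3) \<rho> \<rho>_le_1 \<epsilon> by (intro mult_left_mono add_mono mult_right_mono) auto
  moreover have "5 * \<epsilon> * (5 * \<epsilon>) \<le> 5 * \<epsilon> * ?\<rho>" using \<rho> \<epsilon> by (intro mult_left_mono) auto
  ultimately have "(?\<rho> - 5 * \<epsilon>)\<^sup>2 \<le> (norm (P w))\<^sup>2"
    by (simp add: power2_eq_square algebra_simps)
  then show ?thesis by (rule power2_le_imp_le) simp
qed

section \<open>Duality\<close>

lemma linear_coefficient_nonneg:
  fixes a b :: real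
  assumes "\<And>\<theta>. 0 < \<theta> \<Longrightarrow> \<theta> \<le> 1 \<Longrightarrow> 0 \<le> \<theta> * a + \<theta>\<^sup>2 * b"
  shows "0 \<le> a"
proof (rule tendsto_lowerbound)
  have "((\<lambda>\<theta>. a + \<theta> * b) \<longlongrightarrow> a + 0 * b) (at_right 0)" by (intro tendsto_intros)
  then show "((\<lambda>\<theta>. a + \<theta> * b) \<longlongrightarrow> a) (at_right 0)" by simp
  have "0 \<le> a + \<theta> * b" if "0 < \<theta>" "\<theta> \<le> 1" for \<theta>
  proof -
    have "0 \<le> \<theta> * (a + \<theta> * b)" using assms[OF that] by (simp add: algebra_simps power2_eq_square)
    then show ?thesis using that by (simp add: zero_le_mult_iff)
  qed
  then show "\<forall>\<^sub>F \<theta> in at_right 0. 0 \<le> a + \<theta> * b"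
    by (auto simp: eventually_at_right_field intro!: exI[of _ 1])
qed simp

lemma norm_smoothed_le_quadratic:
  fixes w y :: "'b::real_inner" and e :: real
  assumes "norm (w, e) \<noteq> 0"
  shows "norm (y, e) \<le> norm (w, e) + ((norm y)\<^sup>2 - (norm w)\<^sup>2) / (2 * norm (w, e))"
proof -
  let ?S = "norm (w, e)" and ?N = "norm (y, e)"
  have sq: "?S\<^sup>2 = (norm w)\<^sup>2 + e\<^sup>2" "?N\<^sup>2 = (norm y)\<^sup>2 + e\<^sup>2"
    by (simp_all add: norm_Pair)
  have S: "0 < ?S" using assms by simp
  have "2 * ?S * ?N \<le> ?S\<^sup>2 + ?N\<^sup>2" by (rule sum_squares_bound)
  then show ?thesis using S sq by (simp add: field_simps power2_eq_square)
qed

lemma smoothed_norm_minimiser_gradient: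
  fixes w y :: "'b::real_inner" and e s s\<^sub>0 V :: real
  assumes K: "convex K" "(w, s\<^sub>0) \<in> K" "(y, s) \<in> K"
    and V: "0 \<le> V" and nonzero: "norm (w, e) \<noteq> 0"
    and min: "\<And>y s. (y, s) \<in> K \<Longrightarrow> V * norm (w, e) - s\<^sub>0 \<le> V * norm (y, e) - s"
  shows "s - s\<^sub>0 \<le> inner ((V / norm (w, e)) *\<^sub>R w) (y - w)"
proof -
  let ?S = "norm (w, e)"
  have "0 \<le> \<theta> * (V / ?S * inner w (y - w) - (s - s\<^sub>0)) + \<theta>\<^sup>2 * (V * (norm (y - w))\<^sup>2 / (2 * ?S))"
    if \<theta>: "0 < \<theta>" "\<theta> \<le> 1" for \<theta>
  proof -
    let ?y = "w + \<theta> *\<^sub>R (y - w)" and ?s = "s\<^sub>0 + \<theta> * (s - s\<^sub>0)"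
    have "(1 - \<theta>) *\<^sub>R (w, s\<^sub>0) + \<theta> *\<^sub>R (y, s) \<in> K"
      using \<theta> by (intro convexD[OF K]) auto
    then have "(?y, ?s) \<in> K" by (simp add: algebra_simps)
    then have "V * ?S - s\<^sub>0 \<le> V * norm (?y, e) - ?s" by (rule min)
    moreover have "V * norm (?y, e) \<le> V * (?S + ((norm ?y)\<^sup>2 - (norm w)\<^sup>2) / (2 * ?S))"
      using V nonzero by (intro mult_left_mono norm_smoothed_le_quadratic)
    moreover have "(norm ?y)\<^sup>2 - (norm w)\<^sup>2 = 2 * \<theta> * inner w (y - w) + \<theta>\<^sup>2 * (norm (y - w))\<^sup>2"
      using dot_norm[of w "\<theta> *\<^sub>R (y - w)"] by (simp add: power_mult_distrib)
    ultimately have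
      "0 \<le> V * ((2 * \<theta> * inner w (y - w) + \<theta>\<^sup>2 * (norm (y - w))\<^sup>2) / (2 * ?S)) - \<theta> * (s - s\<^sub>0)"
      by (simp add: distrib_left)
    then show ?thesis using nonzero by (simp add: field_simps)
  qed
  then have "0 \<le> V / ?S * inner w (y - w) - (s - s\<^sub>0)" by (rule linear_coefficient_nonneg)
  then show ?thesis by simp
qed

text \<open>
  Here \<open>u\<close> is the gradient of \<open>V |(\<cdot>, e)|\<close> at a minimiser over \<open>K\<close> of \<open>V |(y, e)| - s\<close>; the
  smoothing by \<open>e\<close> avoids the singularity of the norm at \<open>0\<close>.
\<close>

lemma exists_functional_above_convex_set:
  fixes K :: "('b::real_inner \<times> real) set"
  assumes K: "compact K" "convex K" "K \<noteq> {}"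
    and V: "0 \<le> V" and e: "0 < e"
    and below: "\<And>y s. (y, s) \<in> K \<Longrightarrow> s \<le> V * norm y + a"
  obtains u where "u \<in> span (fst ` K)" "norm u \<le> V"
    "\<And>y s. (y, s) \<in> K \<Longrightarrow> s \<le> inner u y + a + V * e"
proof -
  define \<phi> where "\<phi> = (\<lambda>(y :: 'b, s). V * norm (y, e) - s)"
  have "continuous_on K \<phi>"
    unfolding \<phi>_def case_prod_unfold by (intro continuous_intros)
  then obtain w s\<^sub>0 where w: "(w, s\<^sub>0) \<in> K" and "\<And>z. z \<in> K \<Longrightarrow> \<phi> (w, s\<^sub>0) \<le> \<phi> z"
    using continuous_attains_inf[OF K(1,3)] by (metis surj_pair)
  then have min: "V * norm (w, e) - s\<^sub>0 \<le> V * norm (y, e) - s" if "(y, s) \<in> K" for y s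
    using that by (force simp: \<phi>_def)
  define S where "S = norm (w, e)"
  have S: "0 < S" "norm w \<le> S" "S \<le> norm w + e"
    using e norm_fst_le[of w e] norm_Pair_le[of w e] by (auto simp: S_def prod_eq_iff)
  define u where "u = (V / S) *\<^sub>R w"
  have "u \<in> span (fst ` K)"
    unfolding u_def using w by (intro span_scale span_base) force
  moreover have "norm u \<le> V"
    using mult_left_mono[OF S(2) V] S(1) V by (simp add: u_def pos_divide_le_eq)
  moreover have "s \<le> inner u y + a + V * e" if "(y, s) \<in> K" for y s
  proof -
    have "s - s\<^sub>0 \<le> inner u y - inner u w"
      using smoothed_norm_minimiser_gradient[OF K(2) w that V _ min] S(1)
      by (simp add: u_def S_def inner_diff_right)
    moreover have "norm w * (S - norm w) \<le> S * e" using S e by (intro mult_mono) auto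
    then have "V * (norm w * (S - norm w)) \<le> V * (S * e)" using V by (intro mult_left_mono)
    then have "V * norm w - inner u w \<le> V * e"
      using S by (simp add: u_def power2_norm_eq_inner[symmetric] field_simps power2_eq_square)
    ultimately show ?thesis using below[OF w] by linarith
  qed
  ultimately show thesis by (rule that)
qed

lemma exists_terminal_vector:
  fixes P :: "'a::real_inner \<Rightarrow> 'b::real_inner"
  assumes P: "linear P"
    and T: "finite T" "T \<noteq> {}" "\<And>t. t \<in> T \<Longrightarrow> - t \<in> T"
    and lower: "\<And>w. w \<in> convex hull T \<Longrightarrow> norm w - \<delta> \<le> norm (P w)"
    and \<eta>: "0 < \<eta>"
  shows "\<exists>u\<in>range P. norm u \<le> norm v \<and>
    (\<forall>t\<in>T. \<bar>inner u (P t) - inner v t\<bar> \<le> (\<delta> + \<eta>) * norm v)"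
proof -
  define f where "f t = (P t, inner v t)" for t
  have linear: "linear f"
    unfolding f_def by (intro linearI)
      (simp_all add: linear_add[OF P] linear_scale[OF P] inner_add_right)
  define K where "K = f ` (convex hull T)"
  have K_hull: "K = convex hull (f ` T)"
    unfolding K_def by (rule convex_hull_linear_image[OF linear])
  have K: "compact K" "convex K" "K \<noteq> {}"
    using T(1,2) by (simp_all add: K_hull finite_imp_compact_convex_hull convex_convex_hull)
  have "s \<le> norm v * norm y + norm v * \<delta>" if ys: "(y, s) \<in> K" for y s
  proof -
    obtain w where w: "w \<in> convex hull T" "y = P w" "s = inner v w"
      using ys by (auto simp: K_def f_def)
    have "s \<le> norm v * norm w" unfolding w(3) by (rule norm_cauchy_schwarz)
    also have "\<dots> \<le> norm v * (norm y + \<delta>)"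
      using lower[OF w(1)] w(2) by (intro mult_left_mono) auto
    finally show ?thesis by (simp add: distrib_left)
  qed
  then obtain u where u: "u \<in> span (fst ` K)" "norm u \<le> norm v"
    and above: "\<And>y s. (y, s) \<in> K \<Longrightarrow> s \<le> inner u y + norm v * \<delta> + norm v * \<eta>"
    using exists_functional_above_convex_set[OF K norm_ge_zero \<eta>] by blast
  have "fst ` K \<subseteq> range P" by (auto simp: K_def f_def)
  then have "u \<in> range P"
    using u(1) span_minimal[OF _ linear_subspace_image[OF P subspace_UNIV]] by blast
  moreover have "\<bar>inner u (P t) - inner v t\<bar> \<le> (\<delta> + \<eta>) * norm v" if "t \<in> T" for t
  proof -
    have "inner v t \<le> inner u (P t) + norm v * \<delta> + norm v * \<eta>" if "t \<in> T" for t
      using above hull_inc[OF that, of convex] by (auto simp: K_def f_def)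
    from this[OF that] this[OF T(3)[OF that]] show ?thesis
      by (simp add: linear_neg[OF P] abs_le_iff algebra_simps)
  qed
  ultimately show ?thesis using u(2) by blast
qed

section \<open>Terminal embeddings\<close>

definition additive_terminal_embedding ::
    "'a::metric_space set \<Rightarrow> real \<Rightarrow> ('a \<Rightarrow> 'b::metric_space) \<Rightarrow> bool"
  where "additive_terminal_embedding X \<delta> f \<longleftrightarrow> (\<forall>p\<in>X. \<forall>q. \<bar>dist p q - dist (f p) (f q)\<bar> \<le> \<delta>)"

definition directions :: "'a::real_normed_vector set \<Rightarrow> 'a set"
  where "directions X = (\<lambda>(p, q). sgn (p - q)) ` (X \<times> X)"

lemma finite_directions: "finite X \<Longrightarrow> finite (directions X)"
  by (simp add: directions_def)

lemma card_directions_le: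
  assumes "finite X"
  shows "card (directions X) \<le> (card X)\<^sup>2"
  unfolding directions_def
  using card_image_le[of "X \<times> X"] assms by (simp add: card_cartesian_product power2_eq_square)

lemma sgn_diff_in_directions: "p \<in> X \<Longrightarrow> q \<in> X \<Longrightarrow> sgn (p - q) \<in> directions X"
  by (auto simp: directions_def)

lemma directions_subset_cball: "directions X \<subseteq> cball 0 1"
  by (auto simp: directions_def norm_sgn)

lemma uminus_in_directions: "t \<in> directions X \<Longrightarrow> - t \<in> directions X"
  by (force simp: directions_def simp flip: sgn_minus)

lemma norm_scaleR_sgn: "norm x *\<^sub>R sgn x = x"
  for x :: "'a::real_normed_vector"
  by (cases "x = 0") (simp_all add: sgn_div_norm)

lemma abs_diff_le_of_squares:
  fixes a b k :: real
  assumes "0 \<le> a" "0 \<le> b" "0 \<le> k" "\<bar>a\<^sup>2 - b\<^sup>2\<bar> \<le> k * a"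
  shows "\<bar>a - b\<bar> \<le> k"
proof (cases "a = 0")
  case True
  then show ?thesis using assms by simp
next
  case False
  have "\<bar>a - b\<bar> * a \<le> \<bar>a - b\<bar> * (a + b)" using assms by (intro mult_left_mono) auto
  also have "\<dots> = \<bar>a\<^sup>2 - b\<^sup>2\<bar>"
    using assms by (simp add: power2_eq_square square_diff_square_factored abs_mult)
  also have "\<dots> \<le> k * a" by (rule assms)
  finally show ?thesis using False assms by simp
qed

definition orthogonal_lift :: "'b::real_inner \<Rightarrow> real \<Rightarrow> 'b \<Rightarrow> 'b"
  where "orthogonal_lift e \<rho> u = u + sqrt (\<rho>\<^sup>2 - (norm u)\<^sup>2) *\<^sub>R e"

lemma norm_diff_orthogonal_lift_sq:
  assumes "norm e = 1" "inner e u = 0" "inner e y = 0" "norm u \<le> \<rho>"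
  shows "(norm (y - orthogonal_lift e \<rho> u))\<^sup>2 = (norm y)\<^sup>2 - 2 * inner u y + \<rho>\<^sup>2"
proof -
  define c where "c = sqrt (\<rho>\<^sup>2 - (norm u)\<^sup>2)"
  have "c\<^sup>2 = \<rho>\<^sup>2 - (norm u)\<^sup>2" using assms(4) by (simp add: c_def power_mono)
  moreover have "inner u e = 0" "inner y e = 0" "inner e e = 1"
    using assms(1-3) by (simp_all add: inner_commute flip: power2_norm_eq_inner)
  ultimately show ?thesis
    using assms(2,3) unfolding orthogonal_lift_def c_def[symmetric] unfolding power2_norm_eq_inner
    by (simp add: inner_diff inner_add inner_commute[of y u] power2_eq_square)
qed

lemma terminal_pair_distortion:
  fixes z v :: "'a::real_inner" and y u e :: "'b::real_inner"
  assumes nonneg: "0 \<le> \<epsilon>" "0 \<le> \<eta>"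
    and e: "norm e = 1" "inner e u = 0" "inner e y = 0"
    and "norm u \<le> norm v" and near: "norm v \<le> norm (z - v)"
    and norm_y: "\<bar>(norm y)\<^sup>2 - (norm z)\<^sup>2\<bar> \<le> \<epsilon> * (norm z)\<^sup>2"
    and inner_u: "\<bar>inner u y - inner v z\<bar> \<le> \<eta> * norm v * norm z"
  shows "\<bar>norm (z - v) - norm (y - orthogonal_lift e (norm v) u)\<bar> \<le> 2 * (\<epsilon> + \<eta>) * norm z"
proof (rule abs_diff_le_of_squares)
  let ?a = "norm (z - v)" and ?b = "norm (y - orthogonal_lift e (norm v) u)"
  have "?a\<^sup>2 = (norm z)\<^sup>2 - 2 * inner v z + (norm v)\<^sup>2"
    by (simp add: power2_norm_eq_inner inner_diff inner_commute)
  moreover have "?b\<^sup>2 = (norm y)\<^sup>2 - 2 * inner u y + (norm v)\<^sup>2"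
    using assms by (intro norm_diff_orthogonal_lift_sq)
  ultimately have "\<bar>?a\<^sup>2 - ?b\<^sup>2\<bar>
      = \<bar>2 * (inner u y - inner v z) - ((norm y)\<^sup>2 - (norm z)\<^sup>2)\<bar>" by simp
  also have "\<dots> \<le> \<bar>2 * (inner u y - inner v z)\<bar> + \<bar>(norm y)\<^sup>2 - (norm z)\<^sup>2\<bar>"
    by (rule abs_triangle_ineq4)
  also have "\<dots> \<le> 2 * (\<eta> * norm v * norm z) + \<epsilon> * (norm z)\<^sup>2"
    using norm_y inner_u by (intro add_mono) (simp_all only: abs_mult, simp)
  also have "\<dots> = norm z * (2 * \<eta> * norm v + \<epsilon> * norm z)"
    by (simp add: algebra_simps power2_eq_square)
  also have "\<dots> \<le> norm z * (2 * \<eta> * ?a + \<epsilon> * (2 * ?a))"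
  proof (intro mult_left_mono add_mono)
    show "norm z \<le> 2 * ?a" using norm_triangle_ineq[of "z - v" v] near by simp
  qed (use nonneg near in simp_all)
  finally show "\<bar>?a\<^sup>2 - ?b\<^sup>2\<bar> \<le> 2 * (\<epsilon> + \<eta>) * norm z * ?a" by (simp add: algebra_simps)
qed (use nonneg in simp_all)

lemma exists_terminal_embedding_of_linear_map:
  fixes P :: "'a::real_inner \<Rightarrow> 'b::real_inner"
  assumes P: "linear P" and e: "norm e = 1" "\<And>x. inner e (P x) = 0"
    and X: "finite X" "X \<noteq> {}" "\<And>p q. p \<in> X \<Longrightarrow> q \<in> X \<Longrightarrow> dist p q \<le> D"
    and nonneg: "0 \<le> \<epsilon>" "0 \<le> \<eta>"
    and norm_P: "\<And>p q. p \<in> X \<Longrightarrow> q \<in> X \<Longrightarrow> preserves_norm_sq \<epsilon> P (p - q)"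
    and terminal_vector: "\<And>v. \<exists>u\<in>range P. norm u \<le> norm v \<and>
      (\<forall>p\<in>X. \<forall>q\<in>X. \<bar>inner u (P (p - q)) - inner v (p - q)\<bar> \<le> \<eta> * norm v * norm (p - q))"
  shows "\<exists>f :: 'a \<Rightarrow> 'b. additive_terminal_embedding X (2 * (\<epsilon> + \<eta>) * D) f \<and>
    range f \<subseteq> span (insert e (range P))"
proof -
  define near where "near q = arg_min_on (\<lambda>p. dist p q) X" for q
  have near: "near q \<in> X" "\<And>p. p \<in> X \<Longrightarrow> dist (near q) q \<le> dist p q" for q
    unfolding near_def using X(1,2) by (auto intro: arg_min_if_finite arg_min_least)
  obtain u where u: "\<And>v. u v \<in> range P" "\<And>v. norm (u v) \<le> norm v"
    "\<And>v p q. p \<in> X \<Longrightarrow> q \<in> X \<Longrightarrow>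
      \<bar>inner (u v) (P (p - q)) - inner v (p - q)\<bar> \<le> \<eta> * norm v * norm (p - q)"
    using terminal_vector by metis
  define f where "f q = P (near q) + orthogonal_lift e (norm (q - near q)) (u (q - near q))" for q
  have f_terminal: "f p = P p" if "p \<in> X" for p
  proof -
    have "near p = p" using near(2)[OF that, of p] by simp
    moreover have "u 0 = 0" using u(2)[of 0] by simp
    ultimately show ?thesis by (simp add: f_def orthogonal_lift_def)
  qed
  have "\<bar>dist p q - dist (f p) (f q)\<bar> \<le> 2 * (\<epsilon> + \<eta>) * D" if p: "p \<in> X" for p q
  proof -
    let ?z = "p - near q" and ?v = "q - near q"
    have "\<bar>norm (?z - ?v) - norm (P ?z - orthogonal_lift e (norm ?v) (u ?v))\<bar>
        \<le> 2 * (\<epsilon> + \<eta>) * norm ?z"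
    proof (rule terminal_pair_distortion)
      show "norm ?v \<le> norm (?z - ?v)"
        using near(2)[OF p, of q] by (simp add: dist_norm norm_minus_commute)
      show "inner e (u ?v) = 0" using u(1)[of ?v] e(2) by auto
    qed (use e nonneg u(2) u(3)[OF p near(1)] norm_P[OF p near(1)] in
        \<open>simp_all add: preserves_norm_sq_def\<close>)
    also have "\<dots> \<le> 2 * (\<epsilon> + \<eta>) * D"
      using X(3)[OF p near(1)[of q]] nonneg by (intro mult_left_mono) (auto simp: dist_norm)
    finally show ?thesis
      by (simp add: dist_norm f_terminal[OF p] f_def[of q] linear_diff[OF P] algebra_simps)
  qed
  moreover have "f q \<in> span (insert e (range P))" for q
    unfolding f_def orthogonal_lift_def using u(1) by (intro span_add span_scale span_base) auto
  ultimately show ?thesis by (auto simp: additive_terminal_embedding_def)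
qed

lemma preserves_sums_differenceD:
  fixes P :: "'a::real_inner \<Rightarrow> 'b::real_inner"
  assumes P: "linear P" "preserves_sums \<epsilon> (directions X) P" and "\<epsilon> \<le> 1" and pq: "p \<in> X" "q \<in> X"
  shows "preserves_norm_sq \<epsilon> P (p - q)"
proof -
  have "preserves_norm_sq \<epsilon> P (sgn (p - q))"
    using P(2) sgn_diff_in_directions[OF pq] \<open>\<epsilon> \<le> 1\<close> by (rule preserves_sums_singleD)
  then have "preserves_norm_sq \<epsilon> P (norm (p - q) *\<^sub>R sgn (p - q))"
    by (rule preserves_norm_sq_scaleR[OF P(1)])
  then show ?thesis by (simp only: norm_scaleR_sgn)
qed

lemma exists_terminal_vector_differences:
  fixes P :: "'a::real_inner \<Rightarrow> 'b::real_inner"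
  assumes P: "linear P" "preserves_sums \<epsilon> (directions X) P" and \<epsilon>: "0 < \<epsilon>" "\<epsilon> \<le> 1"
    and X: "finite X" "X \<noteq> {}"
  shows "\<exists>u\<in>range P. norm u \<le> norm v \<and>
    (\<forall>p\<in>X. \<forall>q\<in>X. \<bar>inner u (P (p - q)) - inner v (p - q)\<bar> \<le> 6 * \<epsilon> * norm v * norm (p - q))"
proof -
  have "directions X \<noteq> {}" using X(2) by (simp add: directions_def)
  then obtain u where u: "u \<in> range P" "norm u \<le> norm v"
    "\<And>t. t \<in> directions X \<Longrightarrow> \<bar>inner u (P t) - inner v t\<bar> \<le> (5 * \<epsilon> + \<epsilon>) * norm v"
    using exists_terminal_vector[OF P(1) finite_directions[OF X(1)] _ uminus_in_directions
      norm_image_ge_on_convex_hull[OF P \<epsilon> finite_directions[OF X(1)] directions_subset_cball] \<epsilon>(1)]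
    by blast
  have "\<bar>inner u (P (p - q)) - inner v (p - q)\<bar> \<le> 6 * \<epsilon> * norm v * norm (p - q)"
    if "p \<in> X" "q \<in> X" for p q
  proof -
    let ?D = "norm (p - q)" and ?t = "sgn (p - q)"
    have "inner u (P (?D *\<^sub>R ?t)) - inner v (?D *\<^sub>R ?t) = ?D * (inner u (P ?t) - inner v ?t)"
      unfolding linear_scale[OF P(1)] by (simp add: right_diff_distrib)
    then have "\<bar>inner u (P (p - q)) - inner v (p - q)\<bar> = ?D * \<bar>inner u (P ?t) - inner v ?t\<bar>"
      by (simp add: norm_scaleR_sgn abs_mult)
    also have "\<dots> \<le> ?D * ((5 * \<epsilon> + \<epsilon>) * norm v)"
      using u(3)[OF sgn_diff_in_directions[OF that]] by (intro mult_left_mono) auto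
    finally show ?thesis by (simp add: algebra_simps)
  qed
  then show ?thesis using u(1,2) by blast
qed

lemma exists_terminal_embedding_of_preserves_sums:
  fixes P :: "'a::real_inner \<Rightarrow> 'b::real_inner"
  assumes P: "linear P" "preserves_sums \<epsilon> (directions X) P" and \<epsilon>: "0 < \<epsilon>" "\<epsilon> \<le> 1"
    and e: "norm e = 1" "\<And>x. inner e (P x) = 0"
    and X: "finite X" "X \<noteq> {}" "\<And>p q. p \<in> X \<Longrightarrow> q \<in> X \<Longrightarrow> dist p q \<le> D"
  shows "\<exists>f :: 'a \<Rightarrow> 'b. additive_terminal_embedding X (14 * \<epsilon> * D) f \<and>
    range f \<subseteq> span (insert e (range P))"
  using preserves_sums_differenceD[OF P \<epsilon>(2)]
    exists_terminal_vector_differences[OF P \<epsilon> X(1,2)] \<epsilon>(1)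
    exists_terminal_embedding_of_linear_map[OF P(1) e X, of \<epsilon> "6 * \<epsilon>"]
  by simp

section \<open>Gaussian matrices\<close>

definition std_gaussian :: "'i set \<Rightarrow> ('i \<Rightarrow> real) measure"
  where "std_gaussian I = (\<Pi>\<^sub>M i\<in>I. std_normal_distribution)"

lemma prob_space_std_gaussian: "prob_space (std_gaussian I)"
  unfolding std_gaussian_def by (intro prob_space_PiM prob_space_normal_density) simp

lemma measurable_std_gaussian_component [measurable (raw)]:
  "i \<in> I \<Longrightarrow> (\<lambda>x. x i) \<in> borel_measurable (std_gaussian I)"
  unfolding std_gaussian_def by measurable

lemma distr_std_gaussian_component:
  assumes "i \<in> I"
  shows "distr (std_gaussian I) borel (\<lambda>x. x i) = std_normal_distribution"
proof -
  have "distr (std_gaussian I) borel (\<lambda>x. x i)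
      = distr (std_gaussian I) std_normal_distribution (\<lambda>x. x i)"
    by (intro distr_cong) simp_all
  also have "\<dots> = std_normal_distribution"
    unfolding std_gaussian_def using assms
    by (intro distr_PiM_component prob_space_normal_density) simp
  finally show ?thesis .
qed

lemma indep_vars_std_gaussian:
  "prob_space.indep_vars (std_gaussian I) (\<lambda>_. borel) (\<lambda>i x. x i) I"
proof (cases "I = {}")
  case True
  interpret prob_space "std_gaussian I" by (rule prob_space_std_gaussian)
  show ?thesis unfolding indep_vars_def indep_sets_def using True by simp
next
  case False
  interpret prob_space "std_gaussian I" by (rule prob_space_std_gaussian)
  have "distr (std_gaussian I) (\<Pi>\<^sub>M i\<in>I. borel) (\<lambda>x. \<lambda>i\<in>I. x i)
      = distr (std_gaussian I) (std_gaussian I) (\<lambda>x. x)"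
    by (intro distr_cong) (auto simp: std_gaussian_def space_PiM cong: sets_PiM_cong)
  also have "\<dots> = (\<Pi>\<^sub>M i\<in>I. std_normal_distribution)"
    by (simp add: distr_id std_gaussian_def)
  also have "\<dots> = (\<Pi>\<^sub>M i\<in>I. distr (std_gaussian I) borel (\<lambda>x. x i))"
    by (intro PiM_cong) (simp_all add: distr_std_gaussian_component)
  finally show ?thesis
    using False by (subst indep_vars_iff_distr_eq_PiM') simp_all
qed

lemma distributed_std_gaussian_linear:
  assumes "finite I" "(\<Sum>i\<in>I. (c i)\<^sup>2) = 1"
  shows "distributed (std_gaussian I) lborel (\<lambda>x. \<Sum>i\<in>I. c i * x i) std_normal_density"
proof -
  interpret prob_space "std_gaussian I" by (rule prob_space_std_gaussian)
  define J where "J = {i \<in> I. c i \<noteq> 0}"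
  have J: "finite J" "J \<subseteq> I" using assms(1) by (auto simp: J_def)
  have sq: "(\<Sum>i\<in>J. (c i)\<^sup>2) = 1"
    using assms by (subst sum.mono_neutral_left[of I]) (auto simp: J_def)
  then have "J \<noteq> {}" by auto
  have "distributed (std_gaussian I) lborel (\<lambda>x. \<Sum>i\<in>J. c i * x i)
      (normal_density (\<Sum>i\<in>J. 0) (sqrt (\<Sum>i\<in>J. \<bar>c i\<bar>\<^sup>2)))"
  proof (rule sum_indep_normal[OF J(1) \<open>J \<noteq> {}\<close>])
    show "indep_vars (\<lambda>_. borel) (\<lambda>i x. c i * x i) J"
      by (rule indep_vars_compose2[OF indep_vars_subset[OF indep_vars_std_gaussian J(2)]]) simp
    fix i assume i: "i \<in> J"
    then show "0 < \<bar>c i\<bar>" by (simp add: J_def)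
    have "distributed (std_gaussian I) lborel (\<lambda>x. x i) std_normal_density"
      using i J(2) by (auto simp: distributed_def distr_std_gaussian_component cong: distr_cong)
    then show "distributed (std_gaussian I) lborel (\<lambda>x. c i * x i) (normal_density 0 \<bar>c i\<bar>)"
      using normal_density_affine[of "\<lambda>x. x i" 0 1 "c i" 0] i by (simp add: J_def)
  qed
  moreover have "(\<Sum>i\<in>J. c i * x i) = (\<Sum>i\<in>I. c i * x i)" for x :: "'a \<Rightarrow> real"
    using assms(1) by (intro sum.mono_neutral_left) (auto simp: J_def)
  ultimately show ?thesis by (simp add: sq)
qed

lemma has_bochner_integral_std_normal_exp_square:
  assumes "h < 1 / 2"
  shows "has_bochner_integral lborel
    (\<lambda>x. std_normal_density x * exp (h * x\<^sup>2)) (1 / sqrt (1 - 2 * h))"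
proof -
  define \<sigma> where "\<sigma> = 1 / sqrt (1 - 2 * h)"
  have \<sigma>: "0 < \<sigma>" "\<sigma>\<^sup>2 = 1 / (1 - 2 * h)" using assms by (simp_all add: \<sigma>_def power_divide)
  have "std_normal_density x * exp (h * x\<^sup>2) = \<sigma> * normal_density 0 \<sigma> x" for x
  proof -
    have "- x\<^sup>2 / 2 + h * x\<^sup>2 = - x\<^sup>2 / (2 * \<sigma>\<^sup>2)" using \<sigma> by (simp add: field_simps)
    moreover have "sqrt (2 * pi * \<sigma>\<^sup>2) = sqrt (2 * pi) * \<sigma>" using \<sigma>(1) by (simp add: real_sqrt_mult)
    ultimately show ?thesis
      using \<sigma>(1) by (simp add: normal_density_def flip: exp_add)
  qed
  moreover have "has_bochner_integral lborel (\<lambda>x. \<sigma> * normal_density 0 \<sigma> x) (\<sigma> * 1)"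
    using \<sigma>(1) integral_normal_density[of \<sigma> 0] by (intro has_bochner_integral_mult_right)
      (auto simp: has_bochner_integral_iff)
  ultimately show ?thesis by (simp add: \<sigma>_def)
qed

lemma inverse_sqrt_le_exp:
  assumes "\<bar>h\<bar> \<le> 1 / 4"
  shows "1 / sqrt (1 - 2 * h) \<le> exp (h + 4 * h\<^sup>2)"
proof -
  have "\<bar>ln (1 + (- 2 * h)) - (- 2 * h)\<bar> \<le> 2 * (- 2 * h)\<^sup>2"
    using assms by (intro abs_ln_one_plus_x_minus_x_bound) simp
  then have "- ln (1 - 2 * h) / 2 \<le> h + 4 * h\<^sup>2" by (simp add: power_mult_distrib)
  moreover have "1 / sqrt (1 - 2 * h) = exp (- ln (1 - 2 * h) / 2)"
  proof -
    have pos: "0 < 1 - 2 * h" using assms by (simp add: abs_le_iff)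
    then have "ln (1 / sqrt (1 - 2 * h)) = - ln (1 - 2 * h) / 2"
      by (simp add: ln_div ln_sqrt)
    with pos show ?thesis by (metis exp_ln real_sqrt_gt_zero zero_less_divide_1_iff)
  qed
  ultimately show ?thesis by simp
qed

lemma std_gaussian_exp_square:
  assumes "finite I" "(\<Sum>i\<in>I. (c i)\<^sup>2) = 1" "\<bar>h\<bar> \<le> 1 / 4"
  shows "integrable (std_gaussian I) (\<lambda>x. exp (h * (\<Sum>i\<in>I. c i * x i)\<^sup>2))"
    and "(\<integral>x. exp (h * (\<Sum>i\<in>I. c i * x i)\<^sup>2) \<partial>std_gaussian I) \<le> exp (h + 4 * h\<^sup>2)"
proof -
  note distributed = distributed_std_gaussian_linear[OF assms(1,2)]
  have moment: "has_bochner_integral lborel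
      (\<lambda>x. std_normal_density x * exp (h * x\<^sup>2)) (1 / sqrt (1 - 2 * h))"
    using assms(3) by (intro has_bochner_integral_std_normal_exp_square) (simp add: abs_le_iff)
  show "integrable (std_gaussian I) (\<lambda>x. exp (h * (\<Sum>i\<in>I. c i * x i)\<^sup>2))"
    using moment distributed_integrable[OF distributed, of "\<lambda>x. exp (h * x\<^sup>2)"]
    by (simp add: has_bochner_integral_iff)
  have "(\<integral>x. exp (h * (\<Sum>i\<in>I. c i * x i)\<^sup>2) \<partial>std_gaussian I) = 1 / sqrt (1 - 2 * h)"
    using moment distributed_integral[OF distributed, of "\<lambda>x. exp (h * x\<^sup>2)"]
    by (simp add: has_bochner_integral_iff)
  then show "(\<integral>x. exp (h * (\<Sum>i\<in>I. c i * x i)\<^sup>2) \<partial>std_gaussian I) \<le> exp (h + 4 * h\<^sup>2)"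
    using inverse_sqrt_le_exp[OF assms(3)] by simp
qed

lemma prob_sum_PiM_ge:
  fixes \<phi> :: "'a \<Rightarrow> real" and b c :: real
  assumes "prob_space N" "finite J"
    and "integrable N (\<lambda>x. exp (\<phi> x))" "(\<integral>x. exp (\<phi> x) \<partial>N) \<le> exp b"
  shows "measure (\<Pi>\<^sub>M j\<in>J. N) {\<omega> \<in> space (\<Pi>\<^sub>M j\<in>J. N). c \<le> (\<Sum>j\<in>J. \<phi> (\<omega> j))}
    \<le> exp (card J * b - c)"
proof -
  interpret N: prob_space N by fact
  interpret J: product_sigma_finite "\<lambda>_. N" by standard
  interpret prob_space "\<Pi>\<^sub>M j\<in>J. N" by (intro prob_space_PiM assms)
  have integrable: "integrable (\<Pi>\<^sub>M j\<in>J. N) (\<lambda>\<omega>. exp (\<Sum>j\<in>J. \<phi> (\<omega> j)))"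
    using J.product_integrable_prod[OF assms(2), of "\<lambda>_ x. exp (\<phi> x)"] assms(2,3)
    by (simp add: exp_sum)
  have "measure (\<Pi>\<^sub>M j\<in>J. N) {\<omega> \<in> space (\<Pi>\<^sub>M j\<in>J. N). c \<le> (\<Sum>j\<in>J. \<phi> (\<omega> j))}
      \<le> exp (- c) * (\<integral>\<omega>. exp (\<Sum>j\<in>J. \<phi> (\<omega> j)) \<partial>(\<Pi>\<^sub>M j\<in>J. N))"
    using Chernoff_ineq_ge[of 1 "space (\<Pi>\<^sub>M j\<in>J. N)" "\<lambda>\<omega>. \<Sum>j\<in>J. \<phi> (\<omega> j)" c]
      integrable integrable_mult_indicator[OF sets.top integrable]
    by (simp add: set_integrable_def set_integral_space)
  also have "(\<integral>\<omega>. exp (\<Sum>j\<in>J. \<phi> (\<omega> j)) \<partial>(\<Pi>\<^sub>M j\<in>J. N)) = (\<integral>x. exp (\<phi> x) \<partial>N) ^ card J"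
    using J.product_integral_prod[OF assms(2), of "\<lambda>_ x. exp (\<phi> x)"] assms(2,3)
    by (simp add: exp_sum)
  also have "\<dots> \<le> exp b ^ card J"
    using assms(4) by (intro power_mono) simp_all
  finally show ?thesis
    by (simp add: exp_minus field_simps flip: exp_of_nat_mult) (simp add: exp_diff field_simps)
qed

definition gaussian_matrix :: "'j set \<Rightarrow> 'i set \<Rightarrow> ('j \<Rightarrow> 'i \<Rightarrow> real) measure"
  where "gaussian_matrix J I = (\<Pi>\<^sub>M j\<in>J. std_gaussian I)"

lemma prob_space_gaussian_matrix: "prob_space (gaussian_matrix J I)"
  unfolding gaussian_matrix_def by (intro prob_space_PiM prob_space_std_gaussian)

lemma measurable_gaussian_matrix_entry [measurable (raw)]:
  assumes "j \<in> J" "i \<in> I"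
  shows "(\<lambda>A. A j i) \<in> borel_measurable (gaussian_matrix J I)"
  unfolding gaussian_matrix_def
  using measurable_compose[OF measurable_component_singleton[OF assms(1)]
    measurable_std_gaussian_component[OF assms(2)]] by simp

lemma gaussian_matrix_tail:
  fixes c :: "'i \<Rightarrow> real" and I :: "'i set" and J :: "'j set" and h t :: real
  defines "M \<equiv> gaussian_matrix J I"
  assumes I: "finite I" "(\<Sum>i\<in>I. (c i)\<^sup>2) = 1" and J: "finite J" and h: "\<bar>h\<bar> \<le> 1 / 4"
  shows "measure M {A \<in> space M. t \<le> h * ((\<Sum>j\<in>J. (\<Sum>i\<in>I. c i * A j i)\<^sup>2) - card J)}
    \<le> exp (card J * (4 * h\<^sup>2) - t)"
proof -
  define \<phi> where "\<phi> x = h * ((\<Sum>i\<in>I. c i * x i)\<^sup>2 - 1)" for x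
  have exp_\<phi>: "exp (\<phi> x) = exp (- h) * exp (h * (\<Sum>i\<in>I. c i * x i)\<^sup>2)" for x
    by (simp add: \<phi>_def algebra_simps flip: exp_add)
  have "(\<integral>x. exp (\<phi> x) \<partial>std_gaussian I) \<le> exp (- h) * exp (h + 4 * h\<^sup>2)"
    unfolding exp_\<phi> using std_gaussian_exp_square(2)[OF I h] by simp
  also have "\<dots> = exp (4 * h\<^sup>2)" by (simp flip: exp_add)
  finally have "measure M {A \<in> space M. t \<le> (\<Sum>j\<in>J. \<phi> (A j))} \<le> exp (card J * (4 * h\<^sup>2) - t)"
    unfolding M_def gaussian_matrix_def using std_gaussian_exp_square(1)[OF I h]
    by (intro prob_sum_PiM_ge prob_space_std_gaussian J) (simp_all add: exp_\<phi>)
  moreover have "(\<Sum>j\<in>J. \<phi> (A j)) = h * ((\<Sum>j\<in>J. (\<Sum>i\<in>I. c i * A j i)\<^sup>2) - card J)" for A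
    by (simp add: \<phi>_def sum_subtractf right_diff_distrib sum_distrib_left)
  ultimately show ?thesis by simp
qed

lemma gaussian_matrix_concentration:
  fixes c :: "'i \<Rightarrow> real" and I :: "'i set" and J :: "'j set" and \<delta> :: real
  defines "M \<equiv> gaussian_matrix J I"
  assumes I: "finite I" "(\<Sum>i\<in>I. (c i)\<^sup>2) = 1" and J: "finite J" and \<delta>: "0 \<le> \<delta>" "\<delta> \<le> 1"
  shows "measure M {A \<in> space M. card J * \<delta> < \<bar>(\<Sum>j\<in>J. (\<Sum>i\<in>I. c i * A j i)\<^sup>2) - card J\<bar>}
    \<le> 2 * exp (- (card J * \<delta>\<^sup>2 / 16))"
proof -
  interpret prob_space M unfolding M_def by (rule prob_space_gaussian_matrix)
  define dev where "dev A = (\<Sum>j\<in>J. (\<Sum>i\<in>I. c i * A j i)\<^sup>2) - card J" for A :: "'j \<Rightarrow> 'i \<Rightarrow> real"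
  define tail where "tail h = {A \<in> space M. card J * (\<delta>\<^sup>2 / 8) \<le> h * dev A}" for h
  have tail_bound: "measure M (tail h) \<le> exp (- (card J * \<delta>\<^sup>2 / 16))" if "\<bar>h\<bar> = \<delta> / 8" for h
  proof -
    have h_sq: "h\<^sup>2 = (\<delta> / 8)\<^sup>2" by (simp flip: that)
    have "card J * (4 * h\<^sup>2) - card J * (\<delta>\<^sup>2 / 8) = - (card J * \<delta>\<^sup>2 / 16)"
      unfolding h_sq by (simp add: power_divide)
    moreover have "\<bar>h\<bar> \<le> 1 / 4" using that \<delta> by simp
    ultimately show ?thesis
      using gaussian_matrix_tail[OF I J, of h "card J * (\<delta>\<^sup>2 / 8)"]
      by (simp only: tail_def dev_def M_def)
  qed
  have "{A \<in> space M. card J * \<delta> < \<bar>dev A\<bar>} \<subseteq> tail (\<delta> / 8) \<union> tail (- \<delta> / 8)"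
  proof
    fix A assume A: "A \<in> {A \<in> space M. card J * \<delta> < \<bar>dev A\<bar>}"
    then have "\<delta> / 8 * (card J * \<delta>) \<le> \<delta> / 8 * \<bar>dev A\<bar>"
      using \<delta>(1) by (intro mult_left_mono) simp_all
    then have "card J * (\<delta>\<^sup>2 / 8) \<le> \<delta> / 8 * dev A \<or> card J * (\<delta>\<^sup>2 / 8) \<le> - \<delta> / 8 * dev A"
      by (cases "0 \<le> dev A") (simp_all add: algebra_simps power2_eq_square)
    then show "A \<in> tail (\<delta> / 8) \<union> tail (- \<delta> / 8)" using A by (auto simp: tail_def)
  qed
  moreover have sets: "tail h \<in> sets M" for h
    unfolding tail_def dev_def M_def by measurable
  ultimately have "measure M {A \<in> space M. card J * \<delta> < \<bar>dev A\<bar>}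
      \<le> measure M (tail (\<delta> / 8) \<union> tail (- \<delta> / 8))"
    by (intro finite_measure_mono) auto
  also have "\<dots> \<le> measure M (tail (\<delta> / 8)) + measure M (tail (- \<delta> / 8))"
    by (intro measure_Un_le sets)
  also have "\<dots> \<le> 2 * exp (- (card J * \<delta>\<^sup>2 / 16))"
    using tail_bound[of "\<delta> / 8"] tail_bound[of "- \<delta> / 8"] \<delta>(1) by simp
  finally show ?thesis by (simp add: dev_def)
qed

section \<open>Random linear maps\<close>

definition matrix_map :: "nat \<Rightarrow> nat \<Rightarrow> (nat \<Rightarrow> nat \<Rightarrow> real) \<Rightarrow> fin_seq \<Rightarrow> fin_seq"
  where "matrix_map m d A x =
    of_coords (\<lambda>j. if j < m then (\<Sum>i<d. coord x i * A j i) / sqrt m else 0)"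

lemma coord_matrix_map:
  "coord (matrix_map m d A x) = (\<lambda>j. if j < m then (\<Sum>i<d. coord x i * A j i) / sqrt m else 0)"
  unfolding matrix_map_def by (rule coord_of_coords[of _ m]) (simp add: mem_Rn_iff)

lemma matrix_map_in_Rn: "coord (matrix_map m d A x) \<in> Rn m"
  by (simp add: coord_matrix_map mem_Rn_iff)

lemma linear_matrix_map: "linear (matrix_map m d A)"
  by (intro linearI fin_seq_eqI)
    (auto simp: coord_matrix_map sum.distrib distrib_right add_divide_distrib sum_distrib_left
      mult.assoc)

lemma norm_sq_matrix_map:
  "(norm (matrix_map m d A x))\<^sup>2 = (\<Sum>j<m. (\<Sum>i<d. coord x i * A j i)\<^sup>2) / m"
  by (simp add: norm_sq_fin_seq[OF matrix_map_in_Rn] coord_matrix_map power_divide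
      flip: sum_divide_distrib)

lemma matrix_map_concentration:
  fixes x :: fin_seq and \<delta> :: real and m d :: nat
  defines "M \<equiv> gaussian_matrix {..<m} {..<d}"
  assumes m: "0 < m" and x: "coord x \<in> Rn d" and \<delta>: "0 \<le> \<delta>" "\<delta> \<le> 1"
  shows "measure M {A \<in> space M. \<not> preserves_norm_sq \<delta> (matrix_map m d A) x}
    \<le> 2 * exp (- (real m * \<delta>\<^sup>2 / 16))"
proof (cases "x = 0")
  case True
  then show ?thesis by (simp add: preserves_norm_sq_def linear_0[OF linear_matrix_map])
next
  case False
  let ?c = "\<lambda>i. coord x i / norm x" and ?scale = "real m / (norm x)\<^sup>2"
  have unit: "(\<Sum>i<d. (?c i)\<^sup>2) = 1"
    using False
    by (simp add: power_divide norm_sq_fin_seq[OF x, symmetric] flip: sum_divide_distrib)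
  have deviation: "(\<Sum>j<m. (\<Sum>i<d. ?c i * A j i)\<^sup>2) - m
      = ?scale * ((norm (matrix_map m d A x))\<^sup>2 - (norm x)\<^sup>2)" for A
    using m False
    by (simp add: norm_sq_matrix_map power_divide right_diff_distrib flip: sum_divide_distrib)
  have "\<delta> * (norm x)\<^sup>2 < \<bar>b\<bar> \<longleftrightarrow> m * \<delta> < \<bar>?scale * b\<bar>" for b
    using m False by (simp add: abs_mult field_simps)
  then have "\<not> preserves_norm_sq \<delta> (matrix_map m d A) x \<longleftrightarrow>
      m * \<delta> < \<bar>(\<Sum>j<m. (\<Sum>i<d. ?c i * A j i)\<^sup>2) - m\<bar>" for A
    unfolding deviation preserves_norm_sq_def not_le .
  then show ?thesis
    using gaussian_matrix_concentration[OF _ unit _ \<delta>, of "{..<m}"] by (simp add: M_def)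
qed

lemma (in prob_space) exists_avoiding_events:
  assumes "finite K" "\<And>k. k \<in> K \<Longrightarrow> B k \<in> events" "(\<Sum>k\<in>K. prob (B k)) < 1"
  obtains \<omega> where "\<omega> \<in> space M" "\<And>k. k \<in> K \<Longrightarrow> \<omega> \<notin> B k"
proof -
  have "prob (\<Union>k\<in>K. B k) \<le> (\<Sum>k\<in>K. prob (B k))"
    using assms(1,2) by (intro finite_measure_subadditive_finite) auto
  also have "\<dots> < prob (space M)" using assms(3) by (simp add: prob_space)
  finally have "\<not> space M \<subseteq> (\<Union>k\<in>K. B k)"
    using finite_measure_mono[of "space M" "\<Union>k\<in>K. B k"] sets.finite_UN[OF assms(1), of B M] assms(2)
    by auto
  then show thesis using that by blast
qed

lemma johnson_lindenstrauss:
  fixes x :: "'k \<Rightarrow> fin_seq" and \<delta> :: "'k \<Rightarrow> real"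
  assumes K: "finite K" and m: "0 < m"
    and x: "\<And>k. k \<in> K \<Longrightarrow> coord (x k) \<in> Rn d"
    and \<delta>: "\<And>k. k \<in> K \<Longrightarrow> 0 \<le> \<delta> k" "\<And>k. k \<in> K \<Longrightarrow> \<delta> k \<le> 1"
    and failure: "(\<Sum>k\<in>K. 2 * exp (- (real m * (\<delta> k)\<^sup>2 / 16))) < 1"
  obtains P where "linear P" "\<And>y. coord (P y) \<in> Rn m"
    "\<And>k. k \<in> K \<Longrightarrow> preserves_norm_sq (\<delta> k) P (x k)"
proof -
  define M where "M = gaussian_matrix {..<m} {..<d}"
  interpret prob_space M unfolding M_def by (rule prob_space_gaussian_matrix)
  define bad where
    "bad k = {A \<in> space M. \<not> preserves_norm_sq (\<delta> k) (matrix_map m d A) (x k)}" for k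
  have "(\<Sum>k\<in>K. prob (bad k)) \<le> (\<Sum>k\<in>K. 2 * exp (- (real m * (\<delta> k)\<^sup>2 / 16)))"
    unfolding bad_def M_def using m x \<delta> by (intro sum_mono matrix_map_concentration)
  also note failure
  finally have bad_prob: "(\<Sum>k\<in>K. prob (bad k)) < 1" .
  have "bad k \<in> events" for k
    unfolding bad_def preserves_norm_sq_def norm_sq_matrix_map M_def by measurable
  then obtain A where "A \<in> space M" "\<And>k. k \<in> K \<Longrightarrow> A \<notin> bad k"
    using exists_avoiding_events[OF K _ bad_prob] by blast
  then show thesis
    using linear_matrix_map matrix_map_in_Rn
    by (intro that[of "matrix_map m d A"]) (auto simp: bad_def)
qed

lemma finite_lists_length_between:
  assumes "finite T"
  shows "finite {ts. set ts \<subseteq> T \<and> length ts \<in> {1..N}}"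
  by (rule finite_subset[OF _ finite_lists_length_le[OF assms, of N]]) auto

lemma sum_lists_power_length:
  fixes a :: real
  assumes "finite T"
  shows "(\<Sum>ts | set ts \<subseteq> T \<and> length ts \<in> {1..N}. a ^ length ts) = (\<Sum>k=1..N. (card T * a) ^ k)"
proof -
  let ?L = "{ts. set ts \<subseteq> T \<and> length ts \<in> {1..N}}"
  have "(\<Sum>ts\<in>?L. a ^ length ts) = (\<Sum>k=1..N. \<Sum>ts\<in>{ts \<in> ?L. length ts = k}. a ^ length ts)"
    by (rule sum.group[symmetric]) (use finite_lists_length_between[OF assms] in auto)
  also have "\<dots> = (\<Sum>k=1..N. \<Sum>ts | set ts \<subseteq> T \<and> length ts = k. a ^ k)"
    by (intro sum.cong) auto
  also have "\<dots> = (\<Sum>k=1..N. (card T * a) ^ k)"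
    by (simp add: card_lists_length_eq[OF assms] power_mult_distrib)
  finally show ?thesis .
qed

lemma sum_lists_power_length_less:
  fixes a :: real
  assumes "finite T" "0 \<le> a" "card T * a \<le> 1 / 4"
  shows "(\<Sum>ts | set ts \<subseteq> T \<and> length ts \<in> {1..N}. a ^ length ts) < 1 / 2"
proof -
  have "(\<Sum>k=1..N. (card T * a) ^ k) \<le> (\<Sum>k=1..N. (1 / 4) ^ k)"
    using assms by (intro sum_mono power_mono) simp_all
  also have "\<dots> = 1 / 3 - 1 / 3 * (1 / 4) ^ N"
    by (induction N) simp_all
  also have "\<dots> < 1 / 2"
    by (rule order.strict_trans1[of _ "1 / 3"]) simp_all
  finally show ?thesis by (simp only: sum_lists_power_length[OF assms(1)])
qed

lemma mult_sqrt_le_1_iff: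
  fixes \<epsilon> :: real and k :: nat
  assumes "0 < \<epsilon>"
  shows "\<epsilon> * sqrt k \<le> 1 \<longleftrightarrow> k \<le> nat \<lfloor>1 / \<epsilon>\<^sup>2\<rfloor>"
proof -
  have "\<epsilon> * sqrt k \<le> 1 \<longleftrightarrow> (\<epsilon> * sqrt k)\<^sup>2 \<le> 1\<^sup>2"
    using assms by (subst power2_le_iff_abs_le) simp_all
  also have "\<dots> \<longleftrightarrow> real k \<le> 1 / \<epsilon>\<^sup>2"
    using assms by (simp add: pos_le_divide_eq power_mult_distrib mult.commute)
  also have "\<dots> \<longleftrightarrow> k \<le> nat \<lfloor>1 / \<epsilon>\<^sup>2\<rfloor>" by (simp add: le_nat_iff le_floor_iff)
  finally show ?thesis .
qed

lemma exists_preserves_sums: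
  fixes T :: "fin_seq set"
  assumes T: "finite T" "\<And>t. t \<in> T \<Longrightarrow> coord t \<in> Rn d" and "0 < \<epsilon>" "0 < m"
    and failure: "card T * exp (- (real m * \<epsilon>\<^sup>2 / 16)) \<le> 1 / 4"
  obtains P where "linear P" "\<And>y. coord (P y) \<in> Rn m" "preserves_sums \<epsilon> T P"
proof -
  define N where "N = nat \<lfloor>1 / \<epsilon>\<^sup>2\<rfloor>"
  define K where "K = {ts. set ts \<subseteq> T \<and> length ts \<in> {1..N}}"
  have short: "\<epsilon> * sqrt (length ts) \<le> 1 \<longleftrightarrow> length ts \<le> N" for ts :: "fin_seq list"
    unfolding N_def by (rule mult_sqrt_le_1_iff[OF \<open>0 < \<epsilon>\<close>])
  have finite: "finite K" unfolding K_def by (rule finite_lists_length_between[OF T(1)])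
  have "(\<Sum>ts\<in>K. 2 * exp (- (real m * (\<epsilon> * sqrt (length ts))\<^sup>2 / 16)))
      = 2 * (\<Sum>ts\<in>K. exp (- (real m * \<epsilon>\<^sup>2 / 16)) ^ length ts)"
    by (simp add: sum_distrib_left power_mult_distrib mult_ac flip: exp_of_nat_mult)
  also have "\<dots> < 1"
    using sum_lists_power_length_less[OF T(1) exp_ge_zero failure, of N] by (simp add: K_def)
  finally have failure_K: "(\<Sum>ts\<in>K. 2 * exp (- (real m * (\<epsilon> * sqrt (length ts))\<^sup>2 / 16))) < 1" .
  have sum_in_Rn: "coord (sum_list ts) \<in> Rn d" if "ts \<in> K" for ts
  proof -
    have "set ts \<subseteq> T" using that by (simp add: K_def)
    then show ?thesis using T(2) by (induction ts) (auto simp: mem_Rn_iff)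
  qed
  have \<delta>: "0 \<le> \<epsilon> * sqrt (length ts)" "\<epsilon> * sqrt (length ts) \<le> 1" if "ts \<in> K" for ts
    using that \<open>0 < \<epsilon>\<close> short[of ts] by (auto simp: K_def)
  obtain P where P: "linear P" "\<And>y. coord (P y) \<in> Rn m"
    "\<And>ts. ts \<in> K \<Longrightarrow> preserves_norm_sq (\<epsilon> * sqrt (length ts)) P (sum_list ts)"
    using johnson_lindenstrauss[where x = sum_list, OF finite \<open>0 < m\<close> sum_in_Rn \<delta> failure_K]
    by blast
  have "preserves_sums \<epsilon> T P"
    unfolding preserves_sums_def
  proof (intro allI impI)
    fix ts assume "set ts \<subseteq> T \<and> \<epsilon> * sqrt (length ts) \<le> 1"
    then have "ts = [] \<or> ts \<in> K" using short[of ts] by (auto simp: K_def Suc_le_eq)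
    then show "preserves_norm_sq (\<epsilon> * sqrt (length ts)) P (sum_list ts)"
      using P(3) linear_0[OF P(1)] by (auto simp: preserves_norm_sq_def)
  qed
  with P show thesis by (intro that)
qed

section \<open>Terminal embeddings of Euclidean point sets\<close>

lemma exists_terminal_embedding_fin_seq:
  fixes X :: "fin_seq set"
  assumes X: "finite X" "X \<noteq> {}" "\<And>p. p \<in> X \<Longrightarrow> coord p \<in> Rn d"
    "\<And>p q. p \<in> X \<Longrightarrow> q \<in> X \<Longrightarrow> dist p q \<le> D"
    and \<epsilon>: "0 < \<epsilon>" "\<epsilon> \<le> 1" and "0 < m"
    and failure: "(real (card X))\<^sup>2 * exp (- (real m * \<epsilon>\<^sup>2 / 16)) \<le> 1 / 4"
  obtains f :: "fin_seq \<Rightarrow> fin_seq" where "additive_terminal_embedding X (14 * \<epsilon> * D) f"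
    "\<And>q. coord (f q) \<in> Rn (Suc m)"
proof -
  have "real (card (directions X)) \<le> (real (card X))\<^sup>2"
    using card_directions_le[OF X(1)] by (simp flip: of_nat_power)
  then have "card (directions X) * exp (- (real m * \<epsilon>\<^sup>2 / 16)) \<le> 1 / 4"
    using failure by (meson exp_ge_zero mult_right_mono order_trans)
  moreover have "coord t \<in> Rn d" if "t \<in> directions X" for t
    using that X(3) by (auto simp: directions_def sgn_div_norm mem_Rn_iff)
  ultimately obtain P where P: "linear P" "\<And>y. coord (P y) \<in> Rn m"
    "preserves_sums \<epsilon> (directions X) P"
    using exists_preserves_sums[OF finite_directions[OF X(1)] _ \<epsilon>(1) \<open>0 < m\<close>] by blast
  have "inner (fin_seq_unit m) (P x) = 0" for x
    using P(2)[of x] by (simp add: inner_fin_seq_unit mem_Rn_iff)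
  then obtain f :: "fin_seq \<Rightarrow> fin_seq" where f: "additive_terminal_embedding X (14 * \<epsilon> * D) f"
    "range f \<subseteq> span (insert (fin_seq_unit m) (range P))"
    using exists_terminal_embedding_of_preserves_sums[OF P(1,3) \<epsilon> norm_fin_seq_unit _ X(1,2,4)]
    by blast
  have "insert (fin_seq_unit m) (range P) \<subseteq> {y. coord y \<in> Rn (Suc m)}"
    using fin_seq_unit_in_Rn P(2) Rn_mono[of m "Suc m"] by auto
  then have "span (insert (fin_seq_unit m) (range P)) \<subseteq> {y. coord y \<in> Rn (Suc m)}"
    by (intro span_minimal subspace_coord_in_Rn)
  with f show thesis by (intro that) auto
qed

lemma exists_terminal_embedding_Rn:
  assumes X: "X \<subseteq> Rn d" "finite X" "X \<noteq> {}" "\<And>p. p \<in> X \<Longrightarrow> norm2 d p \<le> r"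
    and \<epsilon>: "0 < \<epsilon>" "\<epsilon> \<le> 1" and "0 < m"
    and failure: "(real (card X))\<^sup>2 * exp (- (real m * \<epsilon>\<^sup>2 / 16)) \<le> 1 / 4"
  obtains f where "f \<in> Rn d \<rightarrow> Rn (Suc m)"
    "\<And>p q. p \<in> X \<Longrightarrow> q \<in> Rn d \<Longrightarrow> \<bar>dist2 d p q - dist2 (Suc m) (f p) (f q)\<bar> \<le> 28 * \<epsilon> * r"
proof -
  let ?Y = "of_coords ` X"
  have coord: "coord (of_coords x) = x" if "x \<in> Rn d" for x by (rule coord_of_coords[OF that])
  have inj: "inj_on of_coords X" by (rule inj_onI) (metis X(1) coord subsetD)
  have coord_Y: "coord p \<in> Rn d" "coord p \<in> X" if "p \<in> ?Y" for p using that X(1) coord by auto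
  have "dist p q \<le> 2 * r" if pq: "p \<in> ?Y" "q \<in> ?Y" for p q
  proof -
    have "norm p \<le> r" "norm q \<le> r"
      using pq coord_Y X(4) by (simp_all add: norm_fin_seq_eq_norm2[of _ d])
    then show ?thesis using norm_triangle_ineq4[of p q] by (simp add: dist_norm)
  qed
  moreover have "card ?Y = card X" by (rule card_image[OF inj])
  ultimately obtain f :: "fin_seq \<Rightarrow> fin_seq"
    where f: "additive_terminal_embedding ?Y (14 * \<epsilon> * (2 * r)) f" "\<And>q. coord (f q) \<in> Rn (Suc m)"
    using exists_terminal_embedding_fin_seq[of ?Y d "2 * r" \<epsilon> m] X coord_Y \<epsilon> \<open>0 < m\<close> failure
    by (metis finite_imageI image_is_empty)
  show thesis
  proof (rule that)
    show "(\<lambda>x. coord (f (of_coords x))) \<in> Rn d \<rightarrow> Rn (Suc m)" using f(2) by blast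
    fix p q assume p: "p \<in> X" and q: "q \<in> Rn d"
    let ?p = "of_coords p" and ?q = "of_coords q"
    have p_Rn: "p \<in> Rn d" using p X(1) by blast
    have "dist2 d p q = dist ?p ?q"
      using dist_fin_seq_eq_dist2[of ?p d ?q] p_Rn q by (simp add: coord)
    moreover have "dist2 (Suc m) (coord (f ?p)) (coord (f ?q)) = dist (f ?p) (f ?q)"
      by (rule dist_fin_seq_eq_dist2[OF f(2) f(2), symmetric])
    ultimately show "\<bar>dist2 d p q - dist2 (Suc m) (coord (f ?p)) (coord (f ?q))\<bar> \<le> 28 * \<epsilon> * r"
      using f(1) p by (simp add: additive_terminal_embedding_def mult.assoc)
  qed
qed

text \<open>
  With \<open>\<epsilon> = \<alpha> / 28\<close>, the number \<open>64 ln L / \<epsilon>\<^sup>2\<close> of rows is \<open>50176 ln L / \<alpha>\<^sup>2\<close>; rounding up and the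
  extra coordinate cost at most \<open>4 ln L / \<alpha>\<^sup>2\<close>.
\<close>

lemma target_dimension:
  fixes n :: nat
  assumes "0 < \<alpha>" "\<alpha> \<le> 1"
  defines "L \<equiv> max 2 (real n)"
  obtains m where "0 < m" "real (Suc m) \<le> 50180 * (1 / \<alpha>\<^sup>2) * ln L"
    "(real n)\<^sup>2 * exp (- (real m * (\<alpha> / 28)\<^sup>2 / 16)) \<le> 1 / 4"
proof -
  define m where "m = nat \<lceil>50176 * ln L / \<alpha>\<^sup>2\<rceil>"
  have L: "2 \<le> L" "real n \<le> L" by (auto simp: L_def)
  have "ln 2 \<le> ln L" using L by simp
  then have lnL: "1 / 2 \<le> ln L" using ln2_ge_two_thirds by linarith
  have pos: "0 < 50176 * ln L / \<alpha>\<^sup>2" using assms lnL by simp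
  have m_ge: "50176 * ln L / \<alpha>\<^sup>2 \<le> real m" unfolding m_def by (rule real_nat_ceiling_ge)
  have m_le: "real m \<le> 50176 * ln L / \<alpha>\<^sup>2 + 1" using pos unfolding m_def by linarith
  have "\<alpha>\<^sup>2 \<le> 1" using assms by (simp add: power_le_one)
  then have "2 * \<alpha>\<^sup>2 \<le> 4 * ln L" using lnL by linarith
  then have "2 \<le> 4 * ln L / \<alpha>\<^sup>2" using assms by (simp add: pos_le_divide_eq)
  with m_le have upper: "real (Suc m) \<le> 50180 * (1 / \<alpha>\<^sup>2) * ln L" by simp
  have "50176 * ln L \<le> real m * \<alpha>\<^sup>2" using m_ge assms by (simp add: pos_divide_le_eq)
  then have "exp (- (real m * (\<alpha> / 28)\<^sup>2 / 16)) \<le> exp (- (4 * ln L))" by (simp add: power_divide)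
  also have "\<dots> = 1 / L ^ 4"
    using L exp_of_nat_mult[of 4 "ln L"] by (simp add: exp_minus divide_inverse)
  finally have "(real n)\<^sup>2 * exp (- (real m * (\<alpha> / 28)\<^sup>2 / 16)) \<le> L\<^sup>2 * (1 / L ^ 4)"
    using L by (intro mult_mono power_mono) auto
  also have "\<dots> = 1 / L\<^sup>2" using L by (simp add: power2_eq_square power4_eq_xxxx)
  also have "\<dots> \<le> 1 / 2\<^sup>2" using L by (intro divide_left_mono power_mono) auto
  finally show thesis using that[of m] upper pos m_ge by simp
qed

theorem theorem4p3:
  shows "\<exists>C::real. C > 0 \<and>
    (\<forall>(d::nat) (n::nat) (\<alpha>::real) (r::real) (X::(nat \<Rightarrow> real) set).
       0 < \<alpha> \<and> \<alpha> < 1 \<and> r > 0 \<and>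
       X \<subseteq> Rn d \<and> finite X \<and> card X = n \<and>
       (\<forall>p\<in>X. norm2 d p \<le> r) \<and> (\<lambda>i. 0) \<in> X \<longrightarrow>
       (\<exists>(m::nat) (f::(nat \<Rightarrow> real) \<Rightarrow> (nat \<Rightarrow> real)).
          real m \<le> C * (1 / \<alpha>\<^sup>2) * ln (max 2 (real n)) \<and>
          f \<in> Rn d \<rightarrow> Rn m \<and>
          (\<forall>p\<in>X. \<forall>q\<in>Rn d. \<bar>dist2 d p q - dist2 m (f p) (f q)\<bar> \<le> \<alpha> * r)))"
proof (intro exI[of _ "50180::real"] conjI allI impI)
  fix d n :: nat and \<alpha> r :: real and X :: "(nat \<Rightarrow> real) set"
  assume hyps: "0 < \<alpha> \<and> \<alpha> < 1 \<and> r > 0 \<and> X \<subseteq> Rn d \<and> finite X \<and> card X = n \<and>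
       (\<forall>p\<in>X. norm2 d p \<le> r) \<and> (\<lambda>i. 0) \<in> X"
  obtain m where m: "0 < m" "real (Suc m) \<le> 50180 * (1 / \<alpha>\<^sup>2) * ln (max 2 (real n))"
    "(real n)\<^sup>2 * exp (- (real m * (\<alpha> / 28)\<^sup>2 / 16)) \<le> 1 / 4"
    using target_dimension[of \<alpha> n] hyps by auto
  obtain f where "f \<in> Rn d \<rightarrow> Rn (Suc m)"
    "\<And>p q. p \<in> X \<Longrightarrow> q \<in> Rn d \<Longrightarrow> \<bar>dist2 d p q - dist2 (Suc m) (f p) (f q)\<bar> \<le> 28 * (\<alpha> / 28) * r"
    using exists_terminal_embedding_Rn[of X d r "\<alpha> / 28" m] hyps m(1,3) by auto
  then show "\<exists>(m::nat) (f::(nat \<Rightarrow> real) \<Rightarrow> (nat \<Rightarrow> real)).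
          real m \<le> 50180 * (1 / \<alpha>\<^sup>2) * ln (max 2 (real n)) \<and>
          f \<in> Rn d \<rightarrow> Rn m \<and>
          (\<forall>p\<in>X. \<forall>q\<in>Rn d. \<bar>dist2 d p q - dist2 m (f p) (f q)\<bar> \<le> \<alpha> * r)"
    using m(2) by (intro exI[of _ "Suc m"] exI[of _ f]) auto
qed simp

end
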